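(* Let $N:V\to\mathbb{S}^2$ be a non-degenerate admissible realization of a simply connected triangulated surface $M=(V,E,F)$, and let $k:E_{int}\to\mathbb{R}$ be a function. The following are equivalent: (1) There exists an A-minimal surface $f:V^*\to\mathbb{R}^3$ with Gauss map $N$ satisfying, for every interior edge $\{ij\}$, $df(e^*_{ij})=k_{ij}(N_j-N_i)$. (2) The assignment of $k_{ij}(N_j-N_i)$ to each oriented edge $e_{ij}$ defines equal and opposite forces to the two endpoints along every edge that is in equilibrium at every vertex, i.e. for every interior vertex $i$ $$\sum_j k_{ij}(N_j-N_i)=0.$$
   Context: A triangulated surface is a cell decomposition $M=(V,E,F)$ of an oriented surface, with or without boundary, all of whose faces are triangles; $V_{int}$ and $E_{int}$ denote the interior vertices and interior edges. $M^*=(V^*,E^*,F^* )$ is the dual cell decomposition: elements of $V^*$ correspond to faces of $M$. $e_{ij}$ is the oriented edge from $i$ to $j$; for an interior edge, $e_{ij}^*$ is the dual edge oriented from the right face $\phi_r$ of $e_{ij}$ to its left face $\phi_l$. For $N$ defined on $V$, $dN(e_{ij})=N_j-N_i$; for $f$ defined on $V^*$, $df(e^*_{ij})=f_{\phi_l}-f_{\phi_r}$. Sums $\sum_j$ run over the neighbors $j$ of $i$; $k_{ij}=k_{ji}$ is the value on the unoriented edge. A realization is an assignment of positions to vertices; it is non-degenerate if the endpoints of every edge have distinct positions. A realization $N:V\to\mathbb{S}^2\subset\mathbb{R}^3$ is admissible if $N_i\neq -N_j$ for every edge $\{ij\}$. A realization $f:V^*\to\mathbb{R}^3$ is A-minimal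 with Gauss map $N:V\to\mathbb{S}^2$ if $N$ is admissible and for every interior edge $\{ij\}$: $dN(e_{ij})\times df(e^*_{ij})=0$ and $\langle N_i+N_j, df(e^*_{ij})\rangle=0$. *)

theory Defs
  imports "HOL-Analysis.Analysis"
begin

text \<open>
  A cell decomposition of an oriented surface, given by its oriented edges: \<open>opp\<close> reverses an
  oriented edge, \<open>left d\<close> is the face to the left of \<open>d\<close> (\<open>None\<close> if the surface lies only to the
  right of \<open>d\<close>), and \<open>nxt d\<close> is the successor of \<open>d\<close> on the positively oriented boundary of
  \<open>left d\<close>. Several edges may have the same end points.
\<close>

record ('v, 'd, 'f) surface =
  verts :: "'v set"
  oedges :: "'d set"
  faces :: "'f set"
  tail :: "'d \<Rightarrow> 'v"
  opp :: "'d \<Rightarrow> 'd"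
  left :: "'d \<Rightarrow> 'f option"
  nxt :: "'d \<Rightarrow> 'd"

definition head :: "('v, 'd, 'f) surface \<Rightarrow> 'd \<Rightarrow> 'v" where
  "head M d = tail M (opp M d)"

definition right :: "('v, 'd, 'f) surface \<Rightarrow> 'd \<Rightarrow> 'f option" where
  "right M d = left M (opp M d)"

definition edge :: "('v, 'd, 'f) surface \<Rightarrow> 'd \<Rightarrow> 'd set" where
  "edge M d = {d, opp M d}"

definition out_edges :: "('v, 'd, 'f) surface \<Rightarrow> 'v \<Rightarrow> 'd set" where
  "out_edges M v = {d \<in> oedges M. tail M d = v}"

text \<open>
  The pairs \<open>(d, d')\<close> of oriented edges starting at \<open>v\<close> such that \<open>d'\<close> follows \<open>d\<close> in the
  counterclockwise order around \<open>v\<close>, the two bounding a corner of the triangle \<open>left d\<close>.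
\<close>

definition rotation :: "('v, 'd, 'f) surface \<Rightarrow> 'v \<Rightarrow> ('d \<times> 'd) set" where
  "rotation M v =
     {(d, opp M (nxt M (nxt M d))) | d. d \<in> out_edges M v \<and> left M d \<noteq> None}"

text \<open>
  The last three assumptions say that the faces around a vertex form a single finite cycle (at an
  interior vertex) or a single finite chain (at a boundary vertex), i.e. that the vertex has a
  neighbourhood which is a disc or a half-disc.
\<close>

locale triangulated_surface =
  fixes M :: "('v, 'd, 'f) surface"
  assumes tail_in: "d \<in> oedges M \<Longrightarrow> tail M d \<in> verts M"
    and opp_in: "d \<in> oedges M \<Longrightarrow> opp M d \<in> oedges M"
    and opp_opp: "d \<in> oedges M \<Longrightarrow> opp M (opp M d) = d"
    and opp_neq: "d \<in> oedges M \<Longrightarrow> opp M d \<noteq> d"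
    and left_in: "d \<in> oedges M \<Longrightarrow> left M d = Some \<phi> \<Longrightarrow> \<phi> \<in> faces M"
    and left_or_right: "d \<in> oedges M \<Longrightarrow> left M d \<noteq> None \<or> right M d \<noteq> None"
    and tail_nxt: "d \<in> oedges M \<Longrightarrow> left M d \<noteq> None \<Longrightarrow> tail M (nxt M d) = head M d"
    and triangle: "\<phi> \<in> faces M \<Longrightarrow>
        \<exists>a b c. distinct [a, b, c] \<and> {d \<in> oedges M. left M d = Some \<phi>} = {a, b, c} \<and>
                nxt M a = b \<and> nxt M b = c \<and> nxt M c = a"
    and out_nonempty: "v \<in> verts M \<Longrightarrow> out_edges M v \<noteq> {}"
    and out_finite: "v \<in> verts M \<Longrightarrow> finite (out_edges M v)"
    and out_connected: "v \<in> verts M \<Longrightarrow> d \<in> out_edges M v \<Longrightarrow> d' \<in> out_edges M v \<Longrightarrow>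
        (d, d') \<in> (rotation M v \<union> (rotation M v)\<inverse>)\<^sup>*"

definition interior_oedges :: "('v, 'd, 'f) surface \<Rightarrow> 'd set" where
  "interior_oedges M = {d \<in> oedges M. left M d \<noteq> None \<and> right M d \<noteq> None}"

definition interior_verts :: "('v, 'd, 'f) surface \<Rightarrow> 'v set" where
  "interior_verts M = {v \<in> verts M. out_edges M v \<subseteq> interior_oedges M}"

datatype ('v, 'd, 'f) cell = Vertex 'v | Edge "'d set" | Face 'f

definition cells :: "('v, 'd, 'f) surface \<Rightarrow> ('v, 'd, 'f) cell set" where
  "cells M = Vertex ` verts M \<union> (Edge \<circ> edge M) ` oedges M \<union> Face ` faces M"

inductive proper_face ::
    "('v, 'd, 'f) surface \<Rightarrow> ('v, 'd, 'f) cell \<Rightarrow> ('v, 'd, 'f) cell \<Rightarrow> bool"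
  for M where
  "d \<in> oedges M \<Longrightarrow> proper_face M (Vertex (tail M d)) (Edge (edge M d))"
| "d \<in> oedges M \<Longrightarrow> left M d = Some \<phi> \<Longrightarrow> proper_face M (Edge (edge M d)) (Face \<phi>)"
| "d \<in> oedges M \<Longrightarrow> left M d = Some \<phi> \<Longrightarrow> proper_face M (Vertex (tail M d)) (Face \<phi>)"

text \<open>
  The underlying topological space, realized as the barycentric subdivision: its vertices are the
  cells, its simplices the chains of cells, and a point is given by its barycentric coordinates.
  This is the underlying space whenever the closed cells are embedded, which holds as soon as no
  edge is a loop, in particular whenever there is a non-degenerate realization of the vertices.
  The topology is that of pointwise convergence of the coordinates; as the subdivision is locally
  finite, it agrees with the CW topology.
\<close>

definition underlying_space ::
    "('v, 'd, 'f) surface \<Rightarrow> (('v, 'd, 'f) cell \<Rightarrow> real) set" where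
  "underlying_space M =
     {p. (\<forall>c. 0 \<le> p c) \<and> {c. p c \<noteq> 0} \<subseteq> cells M \<and> finite {c. p c \<noteq> 0} \<and>
         (\<forall>c c'. p c \<noteq> 0 \<longrightarrow> p c' \<noteq> 0 \<longrightarrow> c = c' \<or> proper_face M c c' \<or> proper_face M c' c) \<and>
         (\<Sum>c | p c \<noteq> 0. p c) = 1}"

text \<open>For \<open>N\<close> on vertices, and for \<open>f\<close> on faces (the latter for interior edges only):\<close>

definition dV :: "('v, 'd, 'f) surface \<Rightarrow> ('v \<Rightarrow> real^3) \<Rightarrow> 'd \<Rightarrow> real^3" where
  "dV M N d = N (head M d) - N (tail M d)"

definition dF :: "('v, 'd, 'f) surface \<Rightarrow> ('f \<Rightarrow> real^3) \<Rightarrow> 'd \<Rightarrow> real^3" where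
  "dF M f d = f (the (left M d)) - f (the (right M d))"

definition nondegenerate :: "('v, 'd, 'f) surface \<Rightarrow> ('v \<Rightarrow> real^3) \<Rightarrow> bool" where
  "nondegenerate M N \<longleftrightarrow> (\<forall>d\<in>oedges M. N (tail M d) \<noteq> N (head M d))"

definition admissible :: "('v, 'd, 'f) surface \<Rightarrow> ('v \<Rightarrow> real^3) \<Rightarrow> bool" where
  "admissible M N \<longleftrightarrow>
     N \<in> verts M \<rightarrow> sphere 0 1 \<and> (\<forall>d\<in>oedges M. N (tail M d) \<noteq> - N (head M d))"

definition A_minimal ::
    "('v, 'd, 'f) surface \<Rightarrow> ('v \<Rightarrow> real^3) \<Rightarrow> ('f \<Rightarrow> real^3) \<Rightarrow> bool" where
  "A_minimal M N f \<longleftrightarrow> admissible M N \<and>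
     (\<forall>d\<in>interior_oedges M. cross3 (dV M N d) (dF M f d) = 0 \<and>
        (N (tail M d) + N (head M d)) \<bullet> dF M f d = 0)"

definition force ::
    "('v, 'd, 'f) surface \<Rightarrow> ('v \<Rightarrow> real^3) \<Rightarrow> ('d set \<Rightarrow> real) \<Rightarrow> 'd \<Rightarrow> real^3" where
  "force M N k d = k (edge M d) *\<^sub>R dV M N d"

text \<open>
  In equilibrium at \<open>v\<close>: the sum over the edges at \<open>v\<close>, oriented away from \<open>v\<close>, is the sum over
  the neighbours of \<open>v\<close>, a neighbour being counted once for each edge joining it to \<open>v\<close>.
\<close>

definition equilibrium_forces ::
    "('v, 'd, 'f) surface \<Rightarrow> ('v \<Rightarrow> real^3) \<Rightarrow> ('d set \<Rightarrow> real) \<Rightarrow> bool" where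
  "equilibrium_forces M N k \<longleftrightarrow>
     (\<forall>d\<in>interior_oedges M. force M N k (opp M d) = - force M N k d) \<and>
     (\<forall>v\<in>interior_verts M. (\<Sum>d\<in>out_edges M v. force M N k d) = 0)"

end

theory Submission
  imports Defs
begin

text \<open>
  Given \<open>f\<close>, the force on an oriented edge \<open>d\<close> is the difference of the values of \<open>f\<close> on the
  two faces at \<open>d\<close>; going once around an interior vertex, these differences telescope to zero.

  Conversely, the force is an antisymmetric function \<open>w\<close> on the oriented interior edges,
  i.e. a 1-form on the dual decomposition, and equilibrium says that it is closed: it sums to zero
  around every dual face. What has to be shown is that a closed dual 1-form on a simply connected
  surface is exact (\<open>closed_dual_form_exact\<close>). A solution \<open>f\<close> is then automatically A-minimal,
  because \<open>dF\<close> is parallel to \<open>dV\<close>, and \<open>N\<^sub>i + N\<^sub>j\<close> is orthogonal to \<open>N\<^sub>j - N\<^sub>i\<close> for unit vectors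
  (\<open>A_minimal_of_parallel\<close>).

  Exactness is proved by turning \<open>w\<close> into a 1-cocycle on the barycentric subdivision, the flag
  complex of the cells of the surface. Around every cell \<open>c\<close> the form \<open>w\<close> has a primitive \<open>P c\<close> on
  the faces that contain \<open>c\<close>: at a vertex it is obtained by summing \<open>w\<close> along the faces in their
  order around the vertex; the order is cyclic at an interior vertex, where the sum closes up by
  equilibrium, and linear at a boundary vertex, where there is nothing to check
  (\<open>partial_orbit_potential\<close>, \<open>vertex_primitive\<close>). For comparable cells \<open>c\<close> and \<open>c'\<close> the primitives differ by a constant \<open>g c c'\<close> on the faces that contain both
  (\<open>comparable_jump\<close>), and \<open>g\<close> is a cocycle. If \<open>g c c' = h c' - h c\<close>, then \<open>P c + h c\<close> does not
  depend on \<open>c\<close>, and is a global primitive.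

  That a 1-cocycle on a simply connected flag complex is a coboundary
  (\<open>cocycle_is_coboundary\<close>) is deduced from the vanishing of its sum along closed edge walks
  (\<open>closed_walk_sum\<close>). A null homotopy of the polygonal loop that follows the walk is
  subdivided into squares so small that each is mapped into the open star of a vertex of
  the complex, which becomes the label of the square. Squares with a common corner have labels
  in a common simplex, so by the cocycle condition the sum of \<open>g\<close> over the labels is the same along
  all rows of squares. It is zero in the last row, where the homotopy is constant, and is the sum
  along the walk in the first one.
\<close>

section \<open>Flag complexes and fine labellings of squares\<close>

text \<open>
  The geometric realization of the simplicial complex whose simplices are the finite cliques of
  \<open>adj\<close>, in barycentric coordinates. The set where the coordinate \<open>c\<close> is positive is the open star
  of the vertex \<open>c\<close>.
\<close>

definition flag_complex :: "'c set \<Rightarrow> ('c \<Rightarrow> 'c \<Rightarrow> bool) \<Rightarrow> ('c \<Rightarrow> real) set" where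
  "flag_complex X adj =
     {p. (\<forall>c. 0 \<le> p c) \<and> {c. p c \<noteq> 0} \<subseteq> X \<and> finite {c. p c \<noteq> 0} \<and>
         (\<forall>c c'. p c \<noteq> 0 \<longrightarrow> p c' \<noteq> 0 \<longrightarrow> adj c c') \<and> (\<Sum>c | p c \<noteq> 0. p c) = 1}"

lemma positive_coordinate:
  assumes "p \<in> flag_complex X adj"
  shows "\<exists>c. 0 < p c"
proof -
  have "{c. p c \<noteq> 0} \<noteq> {}"
    using assms unfolding flag_complex_def by (metis (mono_tags, lifting) mem_Collect_eq sum.empty zero_neq_one)
  then show ?thesis using assms by (force simp: flag_complex_def less_le)
qed

text \<open>
  The preimages of the open stars cover the compact unit square, so by the Lebesgue number property
  every square of a sufficiently fine grid is mapped into a single open star. The number of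
  subdivisions may be taken to be a multiple of \<open>m\<close>, so that the grid refines the subdivision of the
  unit interval by the corners of a polygon with \<open>m\<close> edges.
\<close>

lemma grid_labelling:
  fixes H :: "real \<times> real \<Rightarrow> 'c \<Rightarrow> real" and m :: nat
  assumes contH: "continuous_on ({0..1} \<times> {0..1}) H"
    and HK: "H \<in> {0..1} \<times> {0..1} \<rightarrow> flag_complex X adj" and "m > 0"
  obtains r label where "r > 0"
    "\<And>i j s t. \<lbrakk>i < m * r; j < m * r; s \<in> {real i / real (m * r)..real (Suc i) / real (m * r)};
       t \<in> {real j / real (m * r)..real (Suc j) / real (m * r)}\<rbrakk> \<Longrightarrow> 0 < H (s, t) (label i j :: 'c)"
proof -
  let ?Q = "{0..1} \<times> {0..1} :: (real \<times> real) set"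
  have "\<exists>A. open A \<and> A \<inter> ?Q = (\<lambda>z. H z c) -` {0<..} \<inter> ?Q" for c
    using continuous_on_product_then_coordinatewise[OF contH, of c] open_greaterThan
    unfolding continuous_on_open_invariant by blast
  then obtain A where A: "\<And>c. open (A c)" "\<And>c. A c \<inter> ?Q = (\<lambda>z. H z c) -` {0<..} \<inter> ?Q"
    by metis
  have cover: "?Q \<subseteq> \<Union> (range A)"
  proof
    fix z assume z: "z \<in> ?Q"
    with HK have "H z \<in> flag_complex X adj" by blast
    then obtain c where "0 < H z c" using positive_coordinate by blast
    with z A(2)[of c] have "z \<in> A c" by blast
    then show "z \<in> \<Union> (range A)" by blast
  qed
  have "compact ?Q" by (intro compact_Times) auto
  from Heine_Borel_lemma[OF this cover] A(1)
  obtain e where e: "0 < e" "\<And>z. z \<in> ?Q \<Longrightarrow> \<exists>G \<in> range A. ball z e \<subseteq> G" by auto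
  obtain r0 :: nat where r0: "2 / e < real r0" using reals_Archimedean2 by blast
  define r where "r = Suc r0"
  define n where "n = m * r"
  have n0: "n > 0" using \<open>m > 0\<close> by (simp add: n_def r_def)
  have "r \<le> n" using \<open>m > 0\<close> by (simp add: n_def)
  then have "2 / e < real n" using r0 by (simp add: r_def)
  then have mesh: "2 / real n < e" using e(1) n0 by (simp add: field_simps)
  have "\<exists>c. \<forall>s\<in>{real i / n..real (Suc i) / n}. \<forall>t\<in>{real j / n..real (Suc j) / n}. 0 < H (s, t) c"
    if ij: "i < n" "j < n" for i j
  proof -
    let ?z = "(real i / n, real j / n)"
    have "?z \<in> ?Q" using ij by auto
    then obtain c where c: "ball ?z e \<subseteq> A c" using e(2) by blast
    have "0 < H (s, t) c"
      if s: "s \<in> {real i / n..real (Suc i) / n}" and t: "t \<in> {real j / n..real (Suc j) / n}" for s t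
    proof -
      have le1: "real (Suc i) / n \<le> 1" "real (Suc j) / n \<le> 1"
        using ij by (auto simp: divide_le_eq_1)
      have "0 \<le> real i / n" "0 \<le> real j / n" by auto
      moreover have "real i / n \<le> s" "s \<le> real (Suc i) / n" "real j / n \<le> t" "t \<le> real (Suc j) / n"
        using s t by auto
      ultimately have "0 \<le> s" "s \<le> 1" "0 \<le> t" "t \<le> 1" using le1 by linarith+
      then have Q: "(s, t) \<in> ?Q" by simp
      have "dist ?z (s, t) \<le> dist (real i / n) s + dist (real j / n) t"
        unfolding dist_Pair_Pair by (rule sqrt_sum_squares_le_sum) auto
      also have "\<dots> \<le> 1 / n + 1 / n"
        using s t by (intro add_mono) (auto simp: dist_real_def add_divide_distrib)
      finally have "(s, t) \<in> ball ?z e" using mesh by simp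
      with c A(2)[of c] Q show ?thesis by blast
    qed
    then show ?thesis by blast
  qed
  then obtain label where lab: "\<And>i j. i < n \<Longrightarrow> j < n \<Longrightarrow>
     \<forall>s\<in>{real i / n..real (Suc i) / n}. \<forall>t\<in>{real j / n..real (Suc j) / n}. 0 < H (s, t) (label i j)"
    by metis
  show thesis
    by (rule that[of r label]) (use lab in \<open>auto simp: n_def r_def\<close>)
qed

text \<open>
  The path that runs through the vertices \<open>b 0, \<dots>, b m\<close> at the times \<open>0, 1/m, \<dots>, 1\<close>, and along a
  straight segment in between. The coordinates are written as sums of hat functions, and not
  piecewise, so that continuity is immediate; repetitions in \<open>b\<close> simply add up.
\<close>

definition polygonal_path :: "(nat \<Rightarrow> 'c) \<Rightarrow> nat \<Rightarrow> real \<Rightarrow> 'c \<Rightarrow> real" where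
  "polygonal_path b m t c = (\<Sum>j | j \<le> m \<and> b j = c. max 0 (1 - \<bar>m * t - j\<bar>))"

lemma polygonal_path_support:
  assumes "polygonal_path b m t c \<noteq> 0"
  obtains j where "j \<le> m" "b j = c" "\<bar>m * t - j\<bar> < 1"
proof -
  have "\<exists>j \<in> {j. j \<le> m \<and> b j = c}. max 0 (1 - \<bar>m * t - j\<bar>) \<noteq> 0"
    using assms unfolding polygonal_path_def by (rule sum.not_neutral_contains_not_neutral) blast
  then show thesis using that by (auto simp: max_def split: if_splits)
qed

lemma polygonal_path_at_vertex:
  assumes "q \<le> m" "m > 0"
  shows "polygonal_path b m (real q / real m) c = (if c = b q then 1 else 0)"
proof -
  have "max 0 (1 - \<bar>m * (real q / real m) - real j\<bar>) = (if j = q then 1 else 0)" for j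
  proof -
    have "real j + 1 \<le> q \<or> j = q \<or> real q + 1 \<le> j"
      by (cases j q rule: linorder_cases) (auto simp flip: of_nat_Suc)
    then show ?thesis using \<open>m > 0\<close> by auto
  qed
  then have "polygonal_path b m (real q / real m) c =
      (\<Sum>j | j \<le> m \<and> b j = c. if j = q then 1 else 0)"
    unfolding polygonal_path_def by (intro sum.cong) auto
  then show ?thesis using assms(1) by auto
qed

lemma continuous_polygonal_path: "continuous_on S (polygonal_path b m)"
  unfolding polygonal_path_def by (intro continuous_intros)

lemma sum_hat_functions:
  fixes x :: real
  assumes "0 \<le> x" "x \<le> real m"
  shows "(\<Sum>j\<le>m. max 0 (1 - \<bar>x - real j\<bar>)) = 1"
  using assms
proof (induction m)
  case (Suc m)
  show ?case
  proof (cases "x \<le> m")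
    case True
    then show ?thesis using Suc by simp
  next
    case False
    have "(\<Sum>j\<le>m. max 0 (1 - \<bar>x - real j\<bar>)) = (\<Sum>j\<le>m. if j = m then 1 - \<bar>x - real m\<bar> else 0)"
    proof (rule sum.cong)
      fix j assume "j \<in> {..m}"
      then have "real j + 1 \<le> m \<or> j = m" by (cases "j = m") (auto simp flip: of_nat_Suc)
      then show "max 0 (1 - \<bar>x - real j\<bar>) = (if j = m then 1 - \<bar>x - real m\<bar> else 0)"
        using False Suc.prems by auto
    qed simp
    then show ?thesis using False Suc.prems by simp
  qed
qed simp

section \<open>Cocycles on simply connected flag complexes\<close>

text \<open>
  A simplicial 1-cocycle with values in an abelian group, as a function on ordered pairs. Since the
  vertices in \<open>cocycle\<close> may coincide, it includes antisymmetry and vanishing on degenerate edges.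
\<close>

locale flag_cocycle =
  fixes X :: "'c set" and adj :: "'c \<Rightarrow> 'c \<Rightarrow> bool" and g :: "'c \<Rightarrow> 'c \<Rightarrow> 'b::ab_group_add"
  assumes adj_refl: "x \<in> X \<Longrightarrow> adj x x"
    and adj_sym: "x \<in> X \<Longrightarrow> y \<in> X \<Longrightarrow> adj x y \<Longrightarrow> adj y x"
    and cocycle: "\<lbrakk>x \<in> X; y \<in> X; z \<in> X; adj x y; adj y z; adj x z\<rbrakk> \<Longrightarrow> g x y + g y z = g x z"
begin

lemma cocycle_same: "x \<in> X \<Longrightarrow> g x x = 0"
  using cocycle[of x x x] adj_refl by simp

lemma cocycle_swap: "\<lbrakk>x \<in> X; y \<in> X; adj x y\<rbrakk> \<Longrightarrow> g y x = - g x y"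
  using cocycle[of x y x] cocycle_same[of x] adj_refl adj_sym
  by (simp add: add_eq_0_iff2 add.commute)

lemma cocycle_at_point:
  assumes "p \<in> flag_complex X adj" "0 < p x" "0 < p y" "0 < p z"
  shows "g x y + g y z = g x z"
  using assms by (intro cocycle) (auto simp: flag_complex_def)

text \<open>
  Within one simplex, here the one that contains \<open>p\<close> in its interior, the cocycle is a difference, and
  sums along walks telescope.
\<close>

lemma chain_sum_at_point:
  fixes l :: "nat \<Rightarrow> 'c"
  assumes "p \<in> flag_complex X adj" and pos: "\<And>j. a \<le> j \<Longrightarrow> j \<le> a + n \<Longrightarrow> 0 < p (l j)"
  shows "(\<Sum>j = a..<a + n. g (l j) (l (Suc j))) = g (l a) (l (a + n))"
  using pos
proof (induction n)
  case 0
  have "0 < p (l a)" using 0 by simp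
  then have "l a \<in> X" using assms(1) by (auto simp: flag_complex_def)
  then show ?case by (simp add: cocycle_same)
next
  case (Suc n)
  have "0 < p (l a)" "0 < p (l (a + n))" "0 < p (l (Suc (a + n)))"
    using Suc.prems by auto
  then show ?case using Suc cocycle_at_point[OF assms(1)] by simp
qed

text \<open>
  The discrete form of homotopy invariance. Here \<open>l i j\<close> is the label of the square in row \<open>i\<close> and
  column \<open>j\<close> of a cylinder with \<open>n\<close> columns, and the points \<open>p\<close> of \<open>inner\<close> are the images of the
  corners where four squares meet. Passing from row \<open>i\<close> to row \<open>i + 1\<close> changes the sum by the
  telescoping sum of the values across the rows.
\<close>

lemma periodic_grid_sum:
  fixes l :: "nat \<Rightarrow> nat \<Rightarrow> 'c"
  assumes wrap: "\<And>i. i \<le> k \<Longrightarrow> l i n = l i 0"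
    and inner: "\<And>i j. \<lbrakk>i < k; j < n\<rbrakk> \<Longrightarrow> \<exists>p \<in> flag_complex X adj.
        0 < p (l i j) \<and> 0 < p (l i (Suc j)) \<and> 0 < p (l (Suc i) j) \<and> 0 < p (l (Suc i) (Suc j))"
    and top: "p \<in> flag_complex X adj" "\<And>j. j \<le> n \<Longrightarrow> 0 < p (l k j)"
  shows "(\<Sum>j<n. g (l 0 j) (l 0 (Suc j))) = 0"
proof -
  have row: "(\<Sum>j<n. g (l i j) (l i (Suc j))) = (\<Sum>j<n. g (l (Suc i) j) (l (Suc i) (Suc j)))"
    if i: "i < k" for i
  proof -
    define v where "v j = g (l i j) (l (Suc i) j)" for j
    have sq: "g (l i j) (l i (Suc j)) = g (l (Suc i) j) (l (Suc i) (Suc j)) + (v j - v (Suc j))"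
      if j: "j < n" for j
    proof -
      obtain p where p: "p \<in> flag_complex X adj" "0 < p (l i j)" "0 < p (l i (Suc j))"
        "0 < p (l (Suc i) j)" "0 < p (l (Suc i) (Suc j))" using inner[OF i j] by blast
      have "g (l i j) (l i (Suc j)) + v (Suc j) = g (l i j) (l (Suc i) (Suc j))"
        unfolding v_def by (rule cocycle_at_point[OF p(1)]) fact+
      moreover have "v j + g (l (Suc i) j) (l (Suc i) (Suc j)) = g (l i j) (l (Suc i) (Suc j))"
        unfolding v_def by (rule cocycle_at_point[OF p(1)]) fact+
      ultimately show ?thesis by (simp add: algebra_simps)
    qed
    have "(\<Sum>j<n. v j - v (Suc j)) = v 0 - v n" by (rule sum_lessThan_telescope')
    also have "\<dots> = 0" using wrap[of i] wrap[of "Suc i"] i by (simp add: v_def)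
    finally show ?thesis by (simp add: sq sum.distrib)
  qed
  have "i \<le> k \<Longrightarrow> (\<Sum>j<n. g (l 0 j) (l 0 (Suc j))) = (\<Sum>j<n. g (l i j) (l i (Suc j)))" for i
    by (induction i) (use row in auto)
  then have "(\<Sum>j<n. g (l 0 j) (l 0 (Suc j))) = (\<Sum>j = 0..<0 + n. g (l k j) (l k (Suc j)))"
    by (simp add: lessThan_atLeast0)
  also have "\<dots> = g (l k 0) (l k n)"
    using chain_sum_at_point[OF top(1), of 0 n "l k"] top(2) by simp
  also have "\<dots> = 0"
    using top wrap[of k] by (force simp: flag_complex_def intro: cocycle_same)
  finally show ?thesis .
qed

lemma polygonal_path_in_flag_complex:
  assumes t: "t \<in> {0..1}"
    and b: "\<And>j. j \<le> m \<Longrightarrow> b j \<in> X" "\<And>j. j < m \<Longrightarrow> adj (b j) (b (Suc j))"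
  shows "polygonal_path b m t \<in> flag_complex X adj"
proof -
  have nonneg: "0 \<le> polygonal_path b m t c" for c
    unfolding polygonal_path_def by (rule sum_nonneg) simp
  have sub: "{c. polygonal_path b m t c \<noteq> 0} \<subseteq> b ` {..m}"
    by (auto elim!: polygonal_path_support)
  have "adj c c'" if c: "polygonal_path b m t c \<noteq> 0" and c': "polygonal_path b m t c' \<noteq> 0" for c c'
  proof -
    obtain j where j: "j \<le> m" "b j = c" "\<bar>m * t - j\<bar> < 1" using polygonal_path_support[OF c] .
    obtain i where i: "i \<le> m" "b i = c'" "\<bar>m * t - i\<bar> < 1" using polygonal_path_support[OF c'] .
    have "\<bar>real i - real j\<bar> < 2" using i(3) j(3) by linarith
    then consider "i = j" | "i = Suc j" | "j = Suc i" by linarith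
    then show ?thesis
    proof cases
      case 1 then show ?thesis using i j b adj_refl by auto
    next
      case 2 then show ?thesis using i j b by auto
    next
      case 3
      then have "adj c' c" using i j b by auto
      then show ?thesis using i j b adj_sym by auto
    qed
  qed
  moreover have "(\<Sum>c | polygonal_path b m t c \<noteq> 0. polygonal_path b m t c) = 1"
  proof -
    have "(\<Sum>c | polygonal_path b m t c \<noteq> 0. polygonal_path b m t c)
        = (\<Sum>c \<in> b ` {..m}. polygonal_path b m t c)"
      using sub by (intro sum.mono_neutral_left) auto
    also have "\<dots> = (\<Sum>j\<le>m. max 0 (1 - \<bar>m * t - real j\<bar>))"
      unfolding polygonal_path_def
      by (subst sum.image_gen[of "{..m}" _ b]) auto
    also have "\<dots> = 1"
      using t by (intro sum_hat_functions) (auto simp: mult_left_le)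
    finally show ?thesis .
  qed
  moreover have "finite {c. polygonal_path b m t c \<noteq> 0}"
    using sub finite_surj by blast
  ultimately show ?thesis
    using nonneg sub b(1) unfolding flag_complex_def by blast
qed

text \<open>
  The polygonal loop along the walk is contracted, and the unit square, on which the homotopy is
  defined, is divided into \<open>n\<^sup>2\<close> labelled squares. Because \<open>n\<close> is a multiple of \<open>m\<close>, the corners of
  the polygon are images of grid points; there the labels of the first row are forced to be the
  corners, and in between they belong to one edge, so that the sum along the first row is the sum
  along the walk.
\<close>

lemma closed_walk_sum:
  fixes b :: "nat \<Rightarrow> 'c"
  assumes sc: "simply_connected (flag_complex X adj)" and m: "m > 0"
    and b: "\<And>j. j \<le> m \<Longrightarrow> b j \<in> X" "\<And>j. j < m \<Longrightarrow> adj (b j) (b (Suc j))" "b m = b 0"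
  shows "(\<Sum>j<m. g (b j) (b (Suc j))) = 0"
proof -
  let ?K = "flag_complex X adj"
  define p where "p = polygonal_path b m"
  have pK: "p t \<in> ?K" if "t \<in> {0..1}" for t
    unfolding p_def using that b by (intro polygonal_path_in_flag_complex)
  have p_pos: "\<exists>j\<le>m. b j = c \<and> \<bar>m * t - j\<bar> < 1" if "0 < p t c" for t :: real and c
  proof -
    from that have "polygonal_path b m t c \<noteq> 0" by (simp add: p_def)
    then obtain j where "j \<le> m" "b j = c" "\<bar>m * t - j\<bar> < 1" by (rule polygonal_path_support)
    then show ?thesis by (intro exI[of _ j] conjI)
  qed
  have p_vertex: "c = b q" if "0 < p (q / m) c" "q \<le> m" for q c
    using that polygonal_path_at_vertex[of q m b c] m by (auto simp: p_def split: if_splits)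
  have p01: "p 1 = p 0"
    using polygonal_path_at_vertex[of m m b] polygonal_path_at_vertex[of 0 m b] m b(3)
    by (auto simp: p_def)
  have "path p" unfolding path_def p_def by (rule continuous_polygonal_path)
  moreover have "path (\<lambda>_. p 0)" by (simp add: path_def)
  ultimately have "homotopic_loops ?K p (\<lambda>_. p 0)"
    using pK p01
    by (intro sc[unfolded simply_connected_def, rule_format])
       (auto simp: path_image_def pathstart_def pathfinish_def)
  then obtain H :: "real \<times> real \<Rightarrow> 'c \<Rightarrow> real" where contH: "continuous_on ({0..1} \<times> {0..1}) H"
    and HK: "H \<in> {0..1} \<times> {0..1} \<rightarrow> ?K"
    and H: "\<forall>t\<in>{0..1}. H (0, t) = p t" "\<forall>t\<in>{0..1}. H (1, t) = p 0"
      "\<forall>s\<in>{0..1}. H (s, 1) = H (s, 0)"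
    unfolding homotopic_loops pathstart_def pathfinish_def o_def by blast
  note H0 = bspec[OF H(1)] and H1 = bspec[OF H(2)] and Hloop = bspec[OF H(3)]
  obtain r label where r: "r > 0" and label:
    "\<And>i j s t. \<lbrakk>i < m * r; j < m * r; s \<in> {real i / real (m * r)..real (Suc i) / real (m * r)};
       t \<in> {real j / real (m * r)..real (Suc j) / real (m * r)}\<rbrakk> \<Longrightarrow> 0 < H (s, t) (label i j)"
    using grid_labelling[OF contH HK m] by blast
  define n where "n = m * r"
  have n: "n > 0" using m r by (simp add: n_def)
  \<comment> \<open>Column \<open>n\<close> is column \<open>0\<close> again: the homotopy passes through loops.\<close>
  define l where "l i j = label i (j mod n)" for i j
  have left: "0 < H (s, j / n) (l i j)"
    if "i < n" "j \<le> n" "s \<in> {i / n..Suc i / n}" for i j s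
  proof (cases "j = n")
    case True
    have "Suc i / n \<le> 1" "0 \<le> i / n" using that by (auto simp: divide_le_eq_1 simp del: of_nat_Suc)
    then have "s \<in> {0..1}" using that(3) unfolding atLeastAtMost_iff by linarith
    with Hloop have "H (s, j / n) = H (s, 0)" using True n by simp
    moreover have "0 < H (s, 0) (label i 0)"
      using that n by (intro label) (auto simp flip: n_def)
    ultimately show ?thesis by (simp add: l_def True)
  next
    case False
    then show ?thesis unfolding l_def using that n
      by (intro label) (auto simp flip: n_def simp: field_simps)
  qed
  have right: "0 < H (s, Suc j / n) (l i j)"
    if "i < n" "j < n" "s \<in> {i / n..Suc i / n}" for i j s
    unfolding l_def using that n
    by (intro label) (auto simp flip: n_def simp: field_simps)
  obtain k where k: "n = Suc k" using n by (cases n) auto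
  have "(\<Sum>j<n. g (l 0 j) (l 0 (Suc j))) = 0"
  proof (rule periodic_grid_sum[where k = k])
    show "l i n = l i 0" for i by (simp add: l_def)
  next
    fix i j assume ij: "i < k" "j < n"
    let ?z = "(Suc i / n, Suc j / n)"
    have "?z \<in> {0..1} \<times> {0..1}" using ij k by (auto simp: divide_le_eq_1 simp del: of_nat_Suc)
    then have "H ?z \<in> ?K" using HK by blast
    moreover have "0 < H ?z (l i j)" "0 < H ?z (l i (Suc j))"
      "0 < H ?z (l (Suc i) j)" "0 < H ?z (l (Suc i) (Suc j))"
      using left[of i "Suc j" "Suc i / n"] left[of "Suc i" "Suc j" "Suc i / n"]
        right[of i j "Suc i / n"] right[of "Suc i" j "Suc i / n"] ij k
      by (auto simp: divide_right_mono)
    ultimately show "\<exists>p\<in>?K. 0 < p (l i j) \<and> 0 < p (l i (Suc j)) \<and>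
        0 < p (l (Suc i) j) \<and> 0 < p (l (Suc i) (Suc j))" by blast
  next
    show "p 0 \<in> ?K" by (rule pK) simp
    show "0 < p 0 (l k j)" if "j \<le> n" for j
      using left[of k j 1] that k H1[of "j / n"] by simp
  qed
  \<comment> \<open>The columns \<open>q * r, \<dots>, q * r + r\<close> of the first row lie over the edge from \<open>b q\<close> to \<open>b (Suc q)\<close>.\<close>
  moreover have "(\<Sum>j = q * r..<q * r + r. g (l 0 j) (l 0 (Suc j))) = g (b q) (b (Suc q))"
    if q: "q < m" for q
  proof -
    have corner: "l 0 (q' * r) = b q'" if "q' \<le> m" for q'
    proof (rule p_vertex[OF _ that])
      have "q' * r \<le> n" using that by (simp add: n_def)
      then have "0 < H (0, (q' * r) / n) (l 0 (q' * r))" using n by (intro left) auto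
      moreover have "real (q' * r) / n = q' / m" using r by (simp add: n_def)
      ultimately show "0 < p (q' / m) (l 0 (q' * r))" using H0[of "q' / m"] that m by simp
    qed
    have mem: "l 0 (q * r + i) \<in> {b q, b (Suc q)}" if "i \<le> r" for i
    proof -
      let ?t = "real (q * r + i) / n"
      have le: "q * r + i \<le> Suc q * r" using that by simp
      also have "\<dots> \<le> n" using q unfolding n_def by (intro mult_right_mono) auto
      finally have "q * r + i \<le> n" .
      then have "0 < H (0, ?t) (l 0 (q * r + i))" "?t \<in> {0..1}" 
        using n left[of 0 "q * r + i" 0] by (auto simp: divide_le_eq_1 simp del: of_nat_add of_nat_mult)
      then have "0 < p ?t (l 0 (q * r + i))" using H0 by simp
      from p_pos[OF this] obtain j where j: "j \<le> m" "b j = l 0 (q * r + i)" "\<bar>m * ?t - j\<bar> < 1" by blast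
      have "m * ?t = q + i / r" using m r by (simp add: n_def field_simps)
      moreover have "0 \<le> i / r" "i / r \<le> 1" using that r by auto
      ultimately have "j = q \<or> j = Suc q" using j(3) by linarith
      with j(2) show ?thesis by auto
    qed
    have "\<exists>y \<in> ?K. 0 < y (b q) \<and> 0 < y (b (Suc q))"
    proof
      \<comment> \<open>The midpoint of the edge lies in the stars of both end points.\<close>
      let ?t = "(q + 1/2) / m"
      have "?t \<in> {0..1}" using q by (simp add: field_simps)
      then show "p ?t \<in> ?K" by (rule pK)
      have "0 < max 0 (1 - \<bar>m * ?t - real j\<bar>)" if "j \<in> {q, Suc q}" for j
        using that m by auto
      then have "0 < p ?t (b j)" if "j \<in> {q, Suc q}" for j
        unfolding p_def polygonal_path_def using that q
        by (intro sum_pos2[where i = j]) auto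
      then show "0 < p ?t (b q) \<and> 0 < p ?t (b (Suc q))" by simp
    qed
    then obtain y where "y \<in> ?K" "0 < y (b q)" "0 < y (b (Suc q))" by blast
    then have "(\<Sum>j = q * r..<q * r + r. g (l 0 j) (l 0 (Suc j))) = g (l 0 (q * r)) (l 0 (q * r + r))"
    proof (intro chain_sum_at_point)
      fix j assume "q * r \<le> j" "j \<le> q * r + r"
      then have "l 0 j \<in> {b q, b (Suc q)}" using mem[of "j - q * r"] by auto
      then show "0 < y (l 0 j)" using \<open>0 < y (b q)\<close> \<open>0 < y (b (Suc q))\<close> by auto
    qed
    also have "\<dots> = g (b q) (b (Suc q))"
      using corner[of q] corner[of "Suc q"] q by (simp add: add.commute)
    finally show ?thesis .
  qed
  ultimately show ?thesis
    using sum.nat_group[of "\<lambda>j. g (l 0 j) (l 0 (Suc j))" r m] by (simp add: n_def)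
qed

text \<open>
  \<open>E\<close> is the adjacency relation of the covering of the 1-skeleton that is defined by \<open>g\<close>. Closed walks
  having sum zero, it is a trivial covering, and the potential \<open>h\<close> is the sheet through a
  base point, chosen in each connected component.
\<close>

theorem cocycle_is_coboundary:
  assumes sc: "simply_connected (flag_complex X adj)"
  obtains h where "\<And>x y. \<lbrakk>x \<in> X; y \<in> X; adj x y\<rbrakk> \<Longrightarrow> g x y = h y - h x"
proof -
  define E where "E = {((x, u), (y, u + g x y)) | x y u. x \<in> X \<and> y \<in> X \<and> adj x y}"
  have "sym E"
  proof (rule symI)
    fix a a' assume "(a, a') \<in> E"
    then obtain x y u where *: "x \<in> X" "y \<in> X" "adj x y" "a = (x, u)" "a' = (y, u + g x y)"
      unfolding E_def by blast
    moreover from this have "a = (x, (u + g x y) + g y x)" by (simp add: cocycle_swap)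
    ultimately show "(a', a) \<in> E" using adj_sym unfolding E_def by blast
  qed
  then have symE: "(a, a') \<in> E\<^sup>* \<Longrightarrow> (a', a) \<in> E\<^sup>*" for a a'
    by (meson sym_rtrancl symD)
  have uniq: "u = u'" if loop: "((x, u), (x, u')) \<in> E\<^sup>*" for x u u'
  proof -
    obtain m a where a: "a 0 = (x, u)" "a m = (x, u')" "\<And>i. i < m \<Longrightarrow> (a i, a (Suc i)) \<in> E"
      using rtrancl_imp_relpow[OF loop] unfolding relpow_fun_conv by blast
    show ?thesis
    proof (cases "m = 0")
      case True then show ?thesis using a by simp
    next
      case False
      define b where "b = fst \<circ> a"
      have step: "b i \<in> X \<and> b (Suc i) \<in> X \<and> adj (b i) (b (Suc i)) \<and>
          snd (a (Suc i)) - snd (a i) = g (b i) (b (Suc i))" if "i < m" for i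
        using a(3)[OF that] unfolding E_def b_def by auto
      have "b j \<in> X" if "j \<le> m" for j
        using step[of j] step[of "m - 1"] that False by (cases "j = m") auto
      then have "(\<Sum>j<m. g (b j) (b (Suc j))) = 0"
        using False step a by (intro closed_walk_sum[OF sc]) (auto simp: b_def)
      moreover have "(\<Sum>j<m. g (b j) (b (Suc j))) = (\<Sum>j<m. snd (a (Suc j)) - snd (a j))"
        using step by (intro sum.cong) auto
      ultimately show ?thesis using a sum_lessThan_telescope[of "\<lambda>j. snd (a j)" m] by simp
    qed
  qed
  define base where "base x = (SOME c. \<exists>u. ((c, 0), (x, u)) \<in> E\<^sup>*)" for x
  define h where "h x = (THE u. ((base x, 0), (x, u)) \<in> E\<^sup>*)" for x
  have h_eq: "h x = u" if "((base x, 0), (x, u)) \<in> E\<^sup>*" for x u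
    unfolding h_def
  proof (rule the_equality)
    show "((base x, 0), (x, u)) \<in> E\<^sup>*" by (rule that)
    show "u' = u" if "((base x, 0), (x, u')) \<in> E\<^sup>*" for u'
      using symE[OF that] \<open>((base x, 0), (x, u)) \<in> E\<^sup>*\<close> uniq rtrancl_trans by metis
  qed
  show thesis
  proof (rule that[of h])
    fix x y assume xy: "x \<in> X" "y \<in> X" "adj x y"
    have fwd: "((x, u), (y, u + g x y)) \<in> E\<^sup>*" for u
      using xy unfolding E_def by blast
    \<comment> \<open>Adjacent vertices can be reached from the same vertices, hence have the same base point.\<close>
    have "(\<exists>u. ((c, 0), (x, u)) \<in> E\<^sup>*) \<longleftrightarrow> (\<exists>u. ((c, 0), (y, u)) \<in> E\<^sup>*)" for c
    proof
      assume "\<exists>u. ((c, 0), (x, u)) \<in> E\<^sup>*"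
      then show "\<exists>u. ((c, 0), (y, u)) \<in> E\<^sup>*" using fwd by (meson rtrancl_trans)
    next
      assume "\<exists>u. ((c, 0), (y, u)) \<in> E\<^sup>*"
      then obtain u where u: "((c, 0), (y, u)) \<in> E\<^sup>*" ..
      have "((y, u), (x, u - g x y)) \<in> E\<^sup>*" using symE[OF fwd[of "u - g x y"]] by simp
      with u show "\<exists>u. ((c, 0), (x, u)) \<in> E\<^sup>*" by (meson rtrancl_trans)
    qed
    then have same: "base x = base y" by (simp add: base_def)
    have "\<exists>u. ((x, 0), (x, u)) \<in> E\<^sup>*" by blast
    then have "\<exists>c. \<exists>u. ((c, 0), (x, u)) \<in> E\<^sup>*" by blast
    then have "\<exists>u. ((base x, 0), (x, u)) \<in> E\<^sup>*" unfolding base_def by (rule someI_ex)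
    then obtain u where u: "((base x, 0), (x, u)) \<in> E\<^sup>*" ..
    have "h x = u" by (rule h_eq) (rule u)
    moreover have "h y = u + g x y"
      by (rule h_eq) (use u fwd[of u] same in \<open>simp add: rtrancl_trans\<close>)
    ultimately show "g x y = h y - h x" by simp
  qed
qed

end

section \<open>Potentials along a cyclic or linear order\<close>

text \<open>
  On a single cycle of \<open>\<sigma>\<close>, partial sums of \<open>w\<close> from an arbitrary starting point satisfy the
  recurrence, the total sum being the obstruction to closing up.
\<close>

lemma sum_zero_orbit_potential:
  fixes w :: "'a \<Rightarrow> 'b::ab_group_add"
  assumes fin: "finite A" and bij: "bij_betw \<sigma> A A"
    and conn: "\<And>x y. x \<in> A \<Longrightarrow> y \<in> A \<Longrightarrow> (x, y) \<in> ({(x, \<sigma> x) | x. x \<in> A} \<union> {(x, \<sigma> x) | x. x \<in> A}\<inverse>)\<^sup>*"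
    and sum: "sum w A = 0"
  shows "\<exists>Q. \<forall>x\<in>A. Q (\<sigma> x) = Q x + w (\<sigma> x)"
proof (cases "A = {}")
  case False
  then obtain a where a: "a \<in> A" by blast
  define e where "e i = (\<sigma> ^^ i) a" for i
  have e_Suc: "e (Suc i) = \<sigma> (e i)" for i by (simp add: e_def)
  have eA: "e i \<in> A" for i
    by (induction i) (use a bij in \<open>auto simp: e_def bij_betw_def\<close>)
  have inj: "\<sigma> x = \<sigma> y \<longleftrightarrow> x = y" if "x \<in> A" "y \<in> A" for x y
    using bij that by (auto simp: bij_betw_def inj_on_def)
  have shift: "e i = e (i + d) \<Longrightarrow> e 0 = e d" for i d
    by (induction i) (auto simp: e_Suc inj eA)
  have "\<not> inj e" using finite_subset[of "range e" A] eA fin by (auto dest: finite_imageD)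
  then obtain i j where "i < j" "e i = e j" unfolding inj_def by (metis linorder_neqE_nat)
  then have "e 0 = e (j - i)" "0 < j - i" using shift[of i "j - i"] by auto
  then have ex: "\<exists>n. 0 < n \<and> e n = a" by (metis e_def funpow_0)
  \<comment> \<open>The length of the cycle: \<open>e\<close> enumerates \<open>A\<close> on \<open>{..<n}\<close>.\<close>
  define n where "n = (LEAST n. 0 < n \<and> e n = a)"
  have n: "0 < n" "e n = a" using LeastI_ex[OF ex] by (auto simp: n_def)
  have minimal: "e d \<noteq> a" if "0 < d" "d < n" for d
    using not_less_Least[of d "\<lambda>n. 0 < n \<and> e n = a"] that by (auto simp: n_def)
  have inj_e: "inj_on e {..<n}"
  proof (rule linorder_inj_onI)
    fix i j assume ij: "i < j" "i \<in> {..<n}" "j \<in> {..<n}"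
    show "e i \<noteq> e j"
    proof
      assume "e i = e j"
      then have "e (j - i) = e 0" using shift[of i "j - i"] ij by simp
      then have "e (j - i) = a" by (simp add: e_def)
      moreover have "0 < j - i" "j - i < n" using ij by auto
      ultimately show False using minimal by blast
    qed
  qed auto
  have fwd: "\<sigma> x \<in> e ` {..<n}" if "x \<in> e ` {..<n}" for x
  proof -
    obtain i where i: "i < n" "x = e i" using \<open>x \<in> e ` {..<n}\<close> by blast
    show ?thesis
    proof (cases "Suc i = n")
      case True
      then have "\<sigma> x = e 0" using i n e_Suc[of i] by (simp add: e_def)
      then show ?thesis using n by blast
    next
      case False
      then show ?thesis using i e_Suc[of i] by (intro image_eqI[of _ _ "Suc i"]) auto
    qed
  qed
  have sub: "e ` {..<n} \<subseteq> A" using eA by blast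
  have "\<sigma> ` (e ` {..<n}) = e ` {..<n}"
    using fwd inj_on_subset[of \<sigma> A "e ` {..<n}"] sub bij
    by (intro endo_inj_surj) (auto simp: bij_betw_def)
  then have bwd: "x \<in> e ` {..<n}" if "\<sigma> x \<in> e ` {..<n}" "x \<in> A" for x
    using that inj sub by (smt (verit) image_iff subsetD)
  have "A \<subseteq> e ` {..<n}"
  proof
    fix y assume "y \<in> A"
    from conn[OF a this] show "y \<in> e ` {..<n}"
    proof (induction rule: rtrancl_induct)
      case base
      have "a = e 0" by (simp add: e_def)
      then show ?case using n by blast
    next
      case (step y z)
      then show ?case using fwd bwd by blast
    qed
  qed
  with sub have A: "e ` {..<n} = A" by blast
  define idx where "idx = the_inv_into {..<n} e"
  have idx: "idx (e i) = i" if "i < n" for i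
    unfolding idx_def using the_inv_into_f_f[OF inj_e] that by simp
  define Q where "Q x = (\<Sum>i = 0..<idx x. w (e (Suc i)))" for x
  have "(\<Sum>i = 0..<n. w (e (Suc i))) = (\<Sum>i<n. w (e i)) + w (e n) - w (e 0)"
    using sum.lessThan_Suc_shift[of "\<lambda>i. w (e i)" n]
    by (simp add: algebra_simps atLeast0LessThan)
  also have "e n = e 0" using n by (simp add: e_def)
  also have "(\<Sum>i<n. w (e i)) = 0" using sum sum.reindex[OF inj_e, of w] A by simp
  finally have total: "(\<Sum>i = 0..<n. w (e (Suc i))) = 0" by simp
  have "Q (\<sigma> x) = Q x + w (\<sigma> x)" if x: "x \<in> A" for x
  proof -
    obtain i where i: "i < n" "x = e i" using x A by blast
    show ?thesis
    proof (cases "Suc i = n")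
      case True
      have "\<sigma> x = e 0" using i n True e_Suc[of i] by (simp add: e_def)
      then have "Q (\<sigma> x) = 0" using idx[of 0] n by (simp add: Q_def)
      also have "\<dots> = Q x + w (\<sigma> x)"
        using total idx[OF i(1)] i e_Suc[of i] unfolding Q_def True[symmetric] by simp
      finally show ?thesis .
    next
      case False
      then show ?thesis
        using i idx[of i] idx[of "Suc i"] e_Suc[of i] by (simp add: Q_def)
    qed
  qed
  then show ?thesis by blast
qed auto

text \<open>
  If \<open>\<rho>\<close> is not defined on all of \<open>A\<close>, it is completed to a permutation by joining the ends of its
  chains to the beginnings. As the values of \<open>w\<close> at the beginnings of chains do not occur in the
  conclusion, one of them can be changed to make the total sum zero.
\<close>

lemma partial_orbit_potential:
  fixes w :: "'a \<Rightarrow> 'b::ab_group_add"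
  assumes fin: "finite A" and sub: "D \<subseteq> A" "\<rho> ` D \<subseteq> A" and inj: "inj_on \<rho> D"
    and conn: "\<And>x y. x \<in> A \<Longrightarrow> y \<in> A \<Longrightarrow> (x, y) \<in> ({(x, \<rho> x) | x. x \<in> D} \<union> {(x, \<rho> x) | x. x \<in> D}\<inverse>)\<^sup>*"
    and sum: "D = A \<Longrightarrow> sum w A = 0"
  shows "\<exists>Q. \<forall>x\<in>D. Q (\<rho> x) = Q x + w (\<rho> x)"
proof -
  have finD: "finite D" using fin sub(1) by (rule rev_finite_subset)
  have "card (\<rho> ` D) = card D" by (rule card_image[OF inj])
  then have "card (A - D) = card (A - \<rho> ` D)"
    using finD sub by (simp add: card_Diff_subset)
  then obtain \<beta> where \<beta>: "bij_betw \<beta> (A - D) (A - \<rho> ` D)"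
    using finite_same_card_bij[of "A - D" "A - \<rho> ` D"] fin by auto
  define \<sigma> where "\<sigma> x = (if x \<in> D then \<rho> x else \<beta> x)" for x
  have "bij_betw \<sigma> (D \<union> (A - D)) (\<rho> ` D \<union> (A - \<rho> ` D))"
  proof (rule bij_betw_combine)
    have "bij_betw \<rho> D (\<rho> ` D)" using inj by (rule inj_on_imp_bij_betw)
    then show "bij_betw \<sigma> D (\<rho> ` D)" by (rule bij_betw_cong[THEN iffD1, rotated]) (simp add: \<sigma>_def)
    show "bij_betw \<sigma> (A - D) (A - \<rho> ` D)"
      using \<beta> by (rule bij_betw_cong[THEN iffD1, rotated]) (simp add: \<sigma>_def)
  qed blast
  then have bij: "bij_betw \<sigma> A A" using sub by (simp add: Un_absorb1)
  obtain w' where w': "\<And>x. x \<in> D \<Longrightarrow> w' (\<rho> x) = w (\<rho> x)" "sum w' A = 0"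
  proof (cases "D = A")
    case True
    then show thesis using that[of w] sum by simp
  next
    case False
    then have "A - D \<noteq> {}" using sub by blast
    then obtain s where s: "s \<in> A" "s \<notin> \<rho> ` D" using bij_betwE[OF \<beta>] by blast
    let ?w = "w(s := - sum w (A - {s}))"
    have "sum ?w A = ?w s + sum ?w (A - {s})" using fin s(1) by (rule sum.remove)
    also have "sum ?w (A - {s}) = sum w (A - {s})" by (intro sum.cong) auto
    finally have "sum ?w A = 0" by simp
    then show thesis using that[of ?w] s(2) by force
  qed
  have "\<exists>Q. \<forall>x\<in>A. Q (\<sigma> x) = Q x + w' (\<sigma> x)"
  proof (rule sum_zero_orbit_potential[OF fin bij _ w'(2)])
    fix x y assume "x \<in> A" "y \<in> A"
    from conn[OF this] show "(x, y) \<in> ({(x, \<sigma> x) | x. x \<in> A} \<union> {(x, \<sigma> x) | x. x \<in> A}\<inverse>)\<^sup>*"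
      by (rule rtrancl_mono[THEN subsetD, rotated]) (use sub in \<open>auto simp: \<sigma>_def\<close>)
  qed
  then obtain Q where Q: "\<And>x. x \<in> A \<Longrightarrow> Q (\<sigma> x) = Q x + w' (\<sigma> x)" by blast
  have "Q (\<rho> x) = Q x + w (\<rho> x)" if "x \<in> D" for x
    using Q[of x] w'(1)[of x] that sub(1) by (auto simp: \<sigma>_def)
  then show ?thesis by blast
qed

section \<open>Rotation around a vertex\<close>

context triangulated_surface
begin

lemma face_boundary:
  assumes "d \<in> oedges M" "left M d \<noteq> None"
  shows "nxt M d \<in> oedges M" "left M (nxt M d) = left M d" "nxt M (nxt M (nxt M d)) = d"
    and "\<lbrakk>d' \<in> oedges M; left M d' = left M d\<rbrakk> \<Longrightarrow> d' \<in> {d, nxt M d, nxt M (nxt M d)}"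
proof -
  obtain \<phi> where \<phi>: "left M d = Some \<phi>" using assms(2) by blast
  then have "\<phi> \<in> faces M" using assms(1) left_in by blast
  then obtain a b c where abc: "distinct [a, b, c]"
    "{d \<in> oedges M. left M d = Some \<phi>} = {a, b, c}" "nxt M a = b" "nxt M b = c" "nxt M c = a"
    using triangle by blast
  then have mem: "x \<in> oedges M \<and> left M x = Some \<phi> \<longleftrightarrow> x \<in> {a, b, c}" for x by blast
  have d: "d \<in> {a, b, c}" using mem[of d] assms(1) \<phi> by blast
  then have "nxt M d \<in> {a, b, c}" using abc by auto
  with mem[of "nxt M d"] \<phi> show "nxt M d \<in> oedges M" "left M (nxt M d) = left M d" by simp_all
  show "nxt M (nxt M (nxt M d)) = d" using d abc by auto
  show "d' \<in> {d, nxt M d, nxt M (nxt M d)}" if "d' \<in> oedges M" "left M d' = left M d"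
    using that mem[of d'] \<phi> d abc by auto
qed

lemma head_opp: "d \<in> oedges M \<Longrightarrow> head M (opp M d) = tail M d"
  by (simp add: head_def opp_opp)

lemma right_opp: "d \<in> oedges M \<Longrightarrow> right M (opp M d) = left M d"
  by (simp add: right_def opp_opp)

lemma left_opp: "left M (opp M d) = right M d"
  by (simp add: right_def)

lemma edge_opp: "d \<in> oedges M \<Longrightarrow> edge M (opp M d) = edge M d"
  by (auto simp: edge_def opp_opp)

lemma interior_opp: "d \<in> interior_oedges M \<Longrightarrow> opp M d \<in> interior_oedges M"
  by (simp add: interior_oedges_def opp_in left_opp right_opp)

lemma rotation_step:
  assumes "d \<in> out_edges M v" "left M d \<noteq> None"
  shows "opp M (nxt M (nxt M d)) \<in> out_edges M v"
    and "right M (opp M (nxt M (nxt M d))) = left M d"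
proof -
  have d: "d \<in> oedges M" using assms by (simp add: out_edges_def)
  note n1 = face_boundary[OF d assms(2)]
  have n2: "nxt M (nxt M d) \<in> oedges M" "left M (nxt M (nxt M d)) = left M d"
    using face_boundary(1,2)[OF n1(1)] n1(2) assms(2) by auto
  show "right M (opp M (nxt M (nxt M d))) = left M d" using n2 by (simp add: right_opp)
  have "tail M (opp M (nxt M (nxt M d))) = tail M d"
    using tail_nxt[OF n2(1)] n2(2) n1(3) assms(2) by (simp add: head_def)
  then show "opp M (nxt M (nxt M d)) \<in> out_edges M v"
    using opp_in[OF n2(1)] assms(1) by (simp add: out_edges_def)
qed

lemma inj_rotation_step:
  "inj_on (\<lambda>d. opp M (nxt M (nxt M d))) {d \<in> out_edges M v. left M d \<noteq> None}"
proof (rule inj_onI)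
  fix d d' assume d: "d \<in> {d \<in> out_edges M v. left M d \<noteq> None}"
    and d': "d' \<in> {d \<in> out_edges M v. left M d \<noteq> None}"
    and eq: "opp M (nxt M (nxt M d)) = opp M (nxt M (nxt M d'))"
  have nn: "nxt M (nxt M e) \<in> oedges M" "nxt M (nxt M (nxt M e)) = e"
    if "e \<in> {d \<in> out_edges M v. left M d \<noteq> None}" for e
    using that face_boundary(1-3)[of e] face_boundary(1)[of "nxt M e"] by (auto simp: out_edges_def)
  have "nxt M (nxt M d) = nxt M (nxt M d')"
    using opp_opp[OF nn(1)[OF d]] opp_opp[OF nn(1)[OF d']] eq by metis
  then show "d = d'" using nn(2)[OF d] nn(2)[OF d'] by metis
qed

text \<open>
  The predecessor of \<open>d\<close> in the counterclockwise order around \<open>v\<close> is the edge after the reverse of \<open>d\<close> on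
  the boundary of the face to the right.
\<close>

lemma rotation_step_surj:
  assumes "d \<in> out_edges M v" "right M d \<noteq> None"
  obtains d0 where "d0 \<in> out_edges M v" "left M d0 = right M d" "opp M (nxt M (nxt M d0)) = d"
proof
  have d: "d \<in> oedges M" "opp M d \<in> oedges M" "left M (opp M d) \<noteq> None"
    using assms opp_in by (auto simp: out_edges_def left_opp)
  note n = face_boundary[OF d(2,3)]
  show "left M (nxt M (opp M d)) = right M d" using n(2) by (simp add: left_opp)
  show "nxt M (opp M d) \<in> out_edges M v"
    using n(1) tail_nxt[OF d(2,3)] d(1) assms(1) by (simp add: out_edges_def head_opp)
  show "opp M (nxt M (nxt M (nxt M (opp M d)))) = d" using n(3) d(1) by (simp add: opp_opp)
qed

text \<open>
  Rotation around an interior vertex is a permutation of the edges there, and takes the face on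
  the left to the face on the right; so both faces contribute the same sum.
\<close>

lemma sum_dual_differences_around_vertex:
  fixes f :: "'f \<Rightarrow> 'b::ab_group_add"
  assumes v: "v \<in> interior_verts M"
  shows "(\<Sum>d\<in>out_edges M v. f (the (left M d)) - f (the (right M d))) = 0"
proof -
  let ?\<rho> = "\<lambda>d. opp M (nxt M (nxt M d))" and ?O = "out_edges M v"
  have nb: "left M d \<noteq> None" "right M d \<noteq> None" if "d \<in> ?O" for d
    using v that by (auto simp: interior_verts_def interior_oedges_def)
  have "inj_on ?\<rho> ?O"
    by (rule inj_on_subset[OF inj_rotation_step[of v]]) (use nb in auto)
  moreover have "?\<rho> ` ?O = ?O"
  proof
    show "?\<rho> ` ?O \<subseteq> ?O" using rotation_step(1) nb by blast
    show "?O \<subseteq> ?\<rho> ` ?O"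
    proof
      fix d assume d: "d \<in> ?O"
      obtain d0 where "d0 \<in> ?O" "?\<rho> d0 = d" using rotation_step_surj[OF d nb(2)[OF d]] by metis
      then show "d \<in> ?\<rho> ` ?O" by blast
    qed
  qed
  ultimately have "bij_betw ?\<rho> ?O ?O" by (simp add: bij_betw_def)
  then have "(\<Sum>d\<in>?O. f (the (right M (?\<rho> d)))) = (\<Sum>d\<in>?O. f (the (right M d)))"
    by (rule sum.reindex_bij_betw)
  then show ?thesis using rotation_step(2) nb by (simp add: sum_subtractf)
qed

end

section \<open>Exactness of closed dual forms\<close>

text \<open>
  A non-degenerate realization of the vertices excludes loops.
\<close>

locale loopless_surface = triangulated_surface M for M :: "('v, 'd, 'f) surface" +
  assumes no_loop: "d \<in> oedges M \<Longrightarrow> tail M d \<noteq> head M d"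
begin

text \<open>
  The three corners of a triangle lie at different vertices, because its edges are not loops.
\<close>

lemma corner_unique:
  assumes "d \<in> oedges M" "d' \<in> oedges M" "left M d \<noteq> None" "left M d' = left M d"
    and tails: "tail M d' = tail M d"
  shows "d' = d"
proof -
  note n1 = face_boundary[OF assms(1,3)]
  have "left M (nxt M d) \<noteq> None" using n1(2) assms(3) by simp
  note n2 = face_boundary[OF n1(1) this]
  have "left M (nxt M (nxt M d)) \<noteq> None" using n2(2) n1(2) assms(3) by simp
  then have "tail M d = head M (nxt M (nxt M d))" using tail_nxt[OF n2(1)] n1(3) by simp
  then have "tail M (nxt M (nxt M d)) \<noteq> tail M d" using no_loop[OF n2(1)] by simp
  moreover have "tail M (nxt M d) \<noteq> tail M d"
    using tail_nxt[OF assms(1,3)] no_loop[OF assms(1)] by simp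
  ultimately show ?thesis using n1(4)[OF assms(2,4)] tails by auto
qed

text \<open>
  A face at \<open>v\<close> corresponds to the edge starting at \<open>v\<close> that has it on the left, so a primitive is the
  same as a potential along the rotation around \<open>v\<close>. If rotation is defined at all edges, it is surjective, so
  that \<open>v\<close> is interior and the closedness condition applies.
\<close>

lemma vertex_primitive:
  fixes w :: "'d \<Rightarrow> 'b::ab_group_add"
  assumes v: "v \<in> verts M" and closed: "v \<in> interior_verts M \<Longrightarrow> sum w (out_edges M v) = 0"
  shows "\<exists>P. \<forall>d \<in> out_edges M v \<inter> interior_oedges M. P (the (left M d)) - P (the (right M d)) = w d"
proof -
  let ?O = "out_edges M v" and ?\<rho> = "\<lambda>d. opp M (nxt M (nxt M d))"
  define D where "D = {d \<in> ?O. left M d \<noteq> None}"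
  have "\<exists>Q. \<forall>d\<in>D. Q (?\<rho> d) = Q d + w (?\<rho> d)"
  proof (rule partial_orbit_potential[where A = ?O])
    show fin: "finite ?O" by (rule out_finite[OF v])
    show "D \<subseteq> ?O" by (auto simp: D_def)
    show img: "?\<rho> ` D \<subseteq> ?O" using rotation_step(1) by (auto simp: D_def)
    show inj: "inj_on ?\<rho> D" unfolding D_def by (rule inj_rotation_step)
    have "rotation M v = {(d, ?\<rho> d) | d. d \<in> D}" by (auto simp: rotation_def D_def)
    then show "(d, d') \<in> ({(d, ?\<rho> d) | d. d \<in> D} \<union> {(d, ?\<rho> d) | d. d \<in> D}\<inverse>)\<^sup>*"
      if "d \<in> ?O" "d' \<in> ?O" for d d'
      using out_connected[OF v that] by simp
    assume D: "D = ?O"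
    have "?\<rho> ` ?O = ?O" using endo_inj_surj[OF fin] img inj D by simp
    have "?O \<subseteq> interior_oedges M"
    proof
      fix d assume d: "d \<in> ?O"
      then obtain d0 where d0: "d0 \<in> D" "d = ?\<rho> d0" using \<open>?\<rho> ` ?O = ?O\<close> D by blast
      then have "right M d \<noteq> None" using rotation_step(2)[of d0 v] by (auto simp: D_def)
      moreover have "left M d \<noteq> None" using d D by (auto simp: D_def)
      ultimately show "d \<in> interior_oedges M"
        using d by (simp add: interior_oedges_def out_edges_def)
    qed
    then show "sum w ?O = 0" using closed v by (simp add: interior_verts_def)
  qed
  then obtain Q where Q: "\<And>d. d \<in> D \<Longrightarrow> Q (?\<rho> d) = Q d + w (?\<rho> d)" by blast
  define P where "P \<phi> = Q (THE d. d \<in> ?O \<and> left M d = Some \<phi>)" for \<phi>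
  have P: "P (the (left M d)) = Q d" if "d \<in> D" for d
  proof -
    have d: "d \<in> ?O" "left M d \<noteq> None" using that by (auto simp: D_def)
    then have "(THE d'. d' \<in> ?O \<and> left M d' = Some (the (left M d))) = d"
      using corner_unique by (intro the_equality) (auto simp: out_edges_def)
    then show ?thesis by (simp add: P_def)
  qed
  have "P (the (left M d)) - P (the (right M d)) = w d" if "d \<in> ?O \<inter> interior_oedges M" for d
  proof -
    have d: "d \<in> D" "right M d \<noteq> None" using that by (auto simp: D_def interior_oedges_def)
    then obtain d0 where d0: "d0 \<in> ?O" "left M d0 = right M d" "?\<rho> d0 = d"
      using rotation_step_surj[of d v] by (auto simp: D_def)
    then have "d0 \<in> D" using d(2) by (simp add: D_def)
    then show ?thesis using P[OF d(1)] P[of d0] Q[of d0] d0 by simp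
  qed
  then show ?thesis by blast
qed

text \<open>
  The faces of the closed star of the cell \<open>c\<close>, on which a local primitive around \<open>c\<close> is defined.
\<close>

definition star_face :: "('v, 'd, 'f) cell \<Rightarrow> 'f \<Rightarrow> bool" where
  "star_face c \<phi> \<longleftrightarrow> c = Face \<phi> \<or> proper_face M c (Face \<phi>)"

definition comparable :: "('v, 'd, 'f) cell \<Rightarrow> ('v, 'd, 'f) cell \<Rightarrow> bool" where
  "comparable c c' \<longleftrightarrow> c = c' \<or> proper_face M c c' \<or> proper_face M c' c"

lemma star_face_Face: "star_face (Face \<phi>) \<psi> \<longleftrightarrow> \<phi> = \<psi>"
  by (auto simp: star_face_def elim: proper_face.cases)

lemma star_face_Edge:
  assumes "d \<in> oedges M"
  shows "star_face (Edge (edge M d)) \<phi> \<longleftrightarrow> left M d = Some \<phi> \<or> right M d = Some \<phi>"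
proof
  assume "star_face (Edge (edge M d)) \<phi>"
  then obtain d' where d': "d' \<in> oedges M" "edge M d' = edge M d" "left M d' = Some \<phi>"
    by (auto simp: star_face_def elim: proper_face.cases)
  then have "d' = d \<or> d' = opp M d" by (auto simp: edge_def)
  with d' show "left M d = Some \<phi> \<or> right M d = Some \<phi>" by (auto simp: right_def)
next
  assume "left M d = Some \<phi> \<or> right M d = Some \<phi>"
  then show "star_face (Edge (edge M d)) \<phi>"
    using proper_face.intros(2)[of d M \<phi>] proper_face.intros(2)[of "opp M d" M \<phi>] assms
    by (auto simp: star_face_def opp_in left_opp edge_opp)
qed

lemma star_face_Vertex:
  "star_face (Vertex v) \<phi> \<longleftrightarrow> (\<exists>d \<in> out_edges M v. left M d = Some \<phi>)"
  by (auto simp: star_face_def out_edges_def elim: proper_face.cases intro: proper_face.intros)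

lemma star_face_mono:
  assumes "proper_face M c c'" "star_face c' \<phi>"
  shows "star_face c \<phi>"
  using assms(1)
proof cases
  case (1 d)
  then have "left M d = Some \<phi> \<or> right M d = Some \<phi>" using assms(2) star_face_Edge by simp
  then show ?thesis
  proof
    assume "left M d = Some \<phi>"
    then show ?thesis using 1 by (auto simp: star_face_Vertex out_edges_def)
  next
    assume r: "right M d = Some \<phi>"
    then have o: "opp M d \<in> oedges M" "left M (opp M d) \<noteq> None" using 1 opp_in by (auto simp: left_opp)
    have "tail M (nxt M (opp M d)) = tail M d" using tail_nxt[OF o] head_opp 1 by simp
    then show ?thesis
      using face_boundary(1,2)[OF o] r 1 by (auto simp: star_face_Vertex out_edges_def left_opp)
  qed
next
  case (2 d \<phi>')
  then show ?thesis using assms by (simp add: star_face_Face) (simp add: star_face_def)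
next
  case (3 d \<phi>')
  then show ?thesis using assms by (simp add: star_face_Face) (simp add: star_face_def)
qed

lemma star_face_exists:
  assumes "c \<in> cells M"
  shows "\<exists>\<phi>. star_face c \<phi>"
proof -
  have edge: "\<exists>\<phi>. star_face (Edge (edge M d)) \<phi>" if "d \<in> oedges M" for d
    using left_or_right[OF that] star_face_Edge[OF that] by auto
  show ?thesis
  proof (cases c)
    case (Vertex v)
    then obtain d where "d \<in> oedges M" "tail M d = v"
      using assms out_nonempty[of v] by (auto simp: cells_def out_edges_def)
    then show ?thesis using edge[of d] star_face_mono proper_face.intros(1)[of d M] Vertex by blast
  qed (use assms edge in \<open>auto simp: cells_def star_face_Face\<close>)
qed

text \<open>
  A finite chain of cells has a largest element with respect to incidence, namely a cell of
  greatest dimension, and the faces that contain it contain the others.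
\<close>

lemma star_face_common:
  assumes "C \<subseteq> cells M" "finite C" "C \<noteq> {}" and comp: "\<And>c c'. c \<in> C \<Longrightarrow> c' \<in> C \<Longrightarrow> comparable c c'"
  shows "\<exists>\<phi>. \<forall>c\<in>C. star_face c \<phi>"
proof -
  define dim :: "('v, 'd, 'f) cell \<Rightarrow> nat"
    where "dim c = (case c of Vertex _ \<Rightarrow> 0 | Edge _ \<Rightarrow> 1 | Face _ \<Rightarrow> 2)" for c
  have dim: "dim c < dim c'" if "proper_face M c c'" for c c'
    using that by cases (auto simp: dim_def)
  have "Max (dim ` C) \<in> dim ` C" using assms(2,3) by (intro Max_in) auto
  then obtain m where m: "m \<in> C" "dim m = Max (dim ` C)" by auto
  then have max: "dim c \<le> dim m" if "c \<in> C" for c using assms(2) that by simp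
  obtain \<phi> where "star_face m \<phi>" using star_face_exists m(1) assms(1) by blast
  moreover have "c = m \<or> proper_face M c m" if "c \<in> C" for c
    using comp[OF that m(1)] dim[of m c] max[OF that] by (auto simp: comparable_def)
  ultimately show ?thesis using star_face_mono by blast
qed

text \<open>
  The larger of two distinct comparable cells is a face or an edge. If it is a face, no other face
  contains both; if it is an edge, only the faces on its two sides do, and from one of them to the
  other both primitives jump by \<open>w\<close>.
\<close>

lemma comparable_jump:
  fixes P :: "('v, 'd, 'f) cell \<Rightarrow> 'f \<Rightarrow> 'b::ab_group_add"
  assumes vertex: "\<And>d. d \<in> interior_oedges M \<Longrightarrow>
      P (Vertex (tail M d)) (the (left M d)) - P (Vertex (tail M d)) (the (right M d)) = w d"
    and edge: "\<And>d. d \<in> interior_oedges M \<Longrightarrow>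
      P (Edge (edge M d)) (the (left M d)) - P (Edge (edge M d)) (the (right M d)) = w d"
    and comp: "comparable c c'"
    and star: "star_face c \<phi>" "star_face c' \<phi>" "star_face c \<psi>" "star_face c' \<psi>"
  shows "P c \<phi> - P c' \<phi> = P c \<psi> - P c' \<psi>"
proof -
  have *: "P x \<phi> - P y \<phi> = P x \<psi> - P y \<psi>"
    if "proper_face M x y" and y: "star_face y \<phi>" "star_face y \<psi>" for x y
    using that(1)
  proof cases
    case (1 d)
    show ?thesis
    proof (cases "\<phi> = \<psi>")
      case False
      then have lr: "left M d = Some \<phi> \<and> right M d = Some \<psi> \<or> left M d = Some \<psi> \<and> right M d = Some \<phi>"
        using y star_face_Edge[OF 1(3)] 1(2) by auto
      then have "d \<in> interior_oedges M" using 1(3) by (auto simp: interior_oedges_def)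
      then have "P x (the (left M d)) - P x (the (right M d)) = P y (the (left M d)) - P y (the (right M d))"
        using vertex edge 1 by simp
      then show ?thesis using lr by (auto simp: algebra_simps)
    qed simp
  qed (use y star_face_Face in auto)
  show ?thesis using comp *[of c c'] *[of c' c] star unfolding comparable_def
    by (auto simp: algebra_simps)
qed

text \<open>
  A primitive around an edge is inherited from one of its end points, arbitrarily chosen; by
  antisymmetry of \<open>w\<close> it has the right jump for both orientations. At a face the primitive is zero.
\<close>

theorem closed_dual_form_exact:
  fixes w :: "'d \<Rightarrow> 'b::ab_group_add"
  assumes sc: "simply_connected (underlying_space M)"
    and anti: "\<And>d. d \<in> interior_oedges M \<Longrightarrow> w (opp M d) = - w d"
    and closed: "\<And>v. v \<in> interior_verts M \<Longrightarrow> sum w (out_edges M v) = 0"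
  shows "\<exists>f. \<forall>d\<in>interior_oedges M. f (the (left M d)) - f (the (right M d)) = w d"
proof -
  have "\<forall>v. \<exists>P. v \<in> verts M \<longrightarrow> (\<forall>d \<in> out_edges M v \<inter> interior_oedges M.
      P (the (left M d)) - P (the (right M d)) = w d)"
    using vertex_primitive closed by blast
  then obtain PV where PV: "\<And>v d. \<lbrakk>v \<in> verts M; d \<in> out_edges M v \<inter> interior_oedges M\<rbrakk> \<Longrightarrow>
      PV v (the (left M d)) - PV v (the (right M d)) = w d"
    by metis
  define P where "P c = (case c of Vertex v \<Rightarrow> PV v
    | Edge e \<Rightarrow> PV (tail M (SOME d. d \<in> e)) | Face _ \<Rightarrow> (\<lambda>_. 0))" for c :: "('v, 'd, 'f) cell"
  have jumpV: "PV (tail M d) (the (left M d)) - PV (tail M d) (the (right M d)) = w d"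
    if "d \<in> interior_oedges M" for d
    using PV[of "tail M d" d] tail_in[of d] that by (simp add: out_edges_def interior_oedges_def)
  have jumpE: "P (Edge (edge M d)) (the (left M d)) - P (Edge (edge M d)) (the (right M d)) = w d"
    if d: "d \<in> interior_oedges M" for d
  proof -
    define d' where "d' = (SOME d'. d' \<in> edge M d)"
    have "d' \<in> edge M d" unfolding d'_def by (rule someI[of _ d]) (simp add: edge_def)
    then have d': "d' = d \<or> d' = opp M d" by (simp add: edge_def)
    have P: "P (Edge (edge M d)) = PV (tail M d')" by (simp add: P_def d'_def)
    have dM: "d \<in> oedges M" using d by (simp add: interior_oedges_def)
    from d' show ?thesis
    proof
      assume "d' = d" then show ?thesis using jumpV[OF d] P by simp
    next
      assume o: "d' = opp M d"
      show ?thesis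
        using jumpV[OF interior_opp[OF d]] anti[OF d] dM o P
        by (simp add: left_opp right_opp algebra_simps)
    qed
  qed
  have jump: "P c \<phi> - P c' \<phi> = P c \<psi> - P c' \<psi>"
    if "comparable c c'" "star_face c \<phi>" "star_face c' \<phi>" "star_face c \<psi>" "star_face c' \<psi>" for c c' \<phi> \<psi>
    using comparable_jump[of P w c c' \<phi> \<psi>] jumpV jumpE that by (simp add: P_def)
  \<comment> \<open>The difference of the primitives at any common face; by \<open>jump\<close> the choice does not matter.\<close>
  define g where "g c c' = (let \<phi> = SOME \<phi>. star_face c \<phi> \<and> star_face c' \<phi> in P c \<phi> - P c' \<phi>)" for c c'
  have g: "g c c' = P c \<phi> - P c' \<phi>"
    if "comparable c c'" "star_face c \<phi>" "star_face c' \<phi>" for c c' \<phi>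
  proof -
    have "\<exists>\<phi>. star_face c \<phi> \<and> star_face c' \<phi>" using that by blast
    from someI_ex[OF this] show ?thesis unfolding g_def Let_def using jump that by blast
  qed
  interpret flag_cocycle "cells M" comparable g
  proof
    show "comparable x x" for x by (simp add: comparable_def)
    show "comparable x y \<Longrightarrow> comparable y x" for x y by (auto simp: comparable_def)
    fix x y z
    assume *: "x \<in> cells M" "y \<in> cells M" "z \<in> cells M"
      and c: "comparable x y" "comparable y z" "comparable x z"
    have "\<exists>\<phi>. \<forall>c\<in>{x, y, z}. star_face c \<phi>"
      by (rule star_face_common) (use * c in \<open>auto simp: comparable_def\<close>)
    then obtain \<phi> where "star_face x \<phi>" "star_face y \<phi>" "star_face z \<phi>" by blast
    then show "g x y + g y z = g x z" using c by (simp add: g)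
  qed
  have "underlying_space M = flag_complex (cells M) comparable"
    unfolding underlying_space_def flag_complex_def comparable_def ..
  then obtain h where h: "\<And>x y. \<lbrakk>x \<in> cells M; y \<in> cells M; comparable x y\<rbrakk> \<Longrightarrow> g x y = h y - h x"
    using cocycle_is_coboundary sc by metis
  have "h (Face (the (left M d))) - h (Face (the (right M d))) = w d"
    if d: "d \<in> interior_oedges M" for d
  proof -
    have dM: "d \<in> oedges M" using d by (simp add: interior_oedges_def)
    let ?e = "Edge (edge M d)"
    have "h (Face \<phi>) - h ?e = P ?e \<phi>" if star: "star_face ?e \<phi>" for \<phi>
    proof -
      have lr: "left M d = Some \<phi> \<or> right M d = Some \<phi>" using star star_face_Edge[OF dM] by simp
      then have "\<phi> \<in> faces M" using left_in[OF dM] left_in[OF opp_in[OF dM]] by (auto simp: left_opp)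
      moreover have "comparable ?e (Face \<phi>)" using star by (auto simp: comparable_def star_face_def)
      ultimately show ?thesis
        using h[of ?e "Face \<phi>"] g[of ?e "Face \<phi>" \<phi>] star dM
        by (simp add: cells_def star_face_Face P_def)
    qed
    moreover have "star_face ?e (the (left M d))" "star_face ?e (the (right M d))"
      using d star_face_Edge[OF dM] by (auto simp: interior_oedges_def)
    ultimately have "(h (Face (the (left M d))) - h ?e) - (h (Face (the (right M d))) - h ?e) = w d"
      using jumpE[OF d] by simp
    then show ?thesis by simp
  qed
  then show ?thesis by (intro exI[of _ "\<lambda>\<phi>. h (Face \<phi>)"]) blast
qed

end

section \<open>Forces in equilibrium and A-minimal surfaces\<close>

lemma A_minimal_of_parallel:
  assumes adm: "admissible M N" and tri: "triangulated_surface M"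
    and par: "\<forall>d\<in>interior_oedges M. dF M f d = k (edge M d) *\<^sub>R dV M N d"
  shows "A_minimal M N f"
  unfolding A_minimal_def
proof (intro conjI ballI)
  interpret triangulated_surface M by (rule tri)
  show "admissible M N" by (rule adm)
  fix d assume d: "d \<in> interior_oedges M"
  then have dM: "d \<in> oedges M" by (simp add: interior_oedges_def)
  show "cross3 (dV M N d) (dF M f d) = 0" using par d by (simp add: cross_mult_right)
  have "tail M d \<in> verts M" "head M d \<in> verts M"
    using dM tail_in opp_in by (auto simp: head_def)
  then have "norm (N (tail M d)) = 1" "norm (N (head M d)) = 1"
    using adm by (auto simp: admissible_def Pi_iff)
  then have "(N (tail M d) + N (head M d)) \<bullet> dV M N d = 0"
    by (simp add: dV_def norm_eq_1 inner_add_left inner_diff_right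
        inner_commute[of "N (head M d)" "N (tail M d)"])
  then show "(N (tail M d) + N (head M d)) \<bullet> dF M f d = 0" using par d by simp
qed

theorem proposition4:
  fixes M :: "('v, 'd, 'f) surface"
    and N :: "'v \<Rightarrow> real^3"
    and k :: "'d set \<Rightarrow> real"
  assumes "triangulated_surface M"
    and "simply_connected (underlying_space M)"
    and "nondegenerate M N"
    and "admissible M N"
  shows "(\<exists>f :: 'f \<Rightarrow> real^3. A_minimal M N f \<and>
            (\<forall>d\<in>interior_oedges M. dF M f d = k (edge M d) *\<^sub>R dV M N d))
         \<longleftrightarrow> equilibrium_forces M N k"
proof -
  interpret triangulated_surface M by (rule assms(1))
  interpret loopless_surface M
    by unfold_locales (use assms(3) in \<open>auto simp: nondegenerate_def\<close>)
  have anti: "force M N k (opp M d) = - force M N k d" if "d \<in> interior_oedges M" for d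
  proof -
    have "d \<in> oedges M" using that by (simp add: interior_oedges_def)
    moreover have "tail M (opp M d) = head M d" by (simp add: head_def)
    ultimately show ?thesis
      by (simp add: force_def dV_def edge_opp head_opp algebra_simps)
  qed
  show ?thesis
  proof
    assume "\<exists>f :: 'f \<Rightarrow> real^3. A_minimal M N f \<and>
            (\<forall>d\<in>interior_oedges M. dF M f d = k (edge M d) *\<^sub>R dV M N d)"
    then obtain f :: "'f \<Rightarrow> real^3"
      where f: "\<And>d. d \<in> interior_oedges M \<Longrightarrow> dF M f d = force M N k d"
      unfolding force_def by blast
    have "(\<Sum>d\<in>out_edges M v. force M N k d) = 0" if v: "v \<in> interior_verts M" for v
    proof -
      have "(\<Sum>d\<in>out_edges M v. force M N k d) = (\<Sum>d\<in>out_edges M v. dF M f d)"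
        using v f by (intro sum.cong) (auto simp: interior_verts_def)
      then show ?thesis using sum_dual_differences_around_vertex[OF v, of f] by (simp add: dF_def)
    qed
    then show "equilibrium_forces M N k" using anti by (simp add: equilibrium_forces_def)
  next
    assume "equilibrium_forces M N k"
    then have "\<exists>f. \<forall>d\<in>interior_oedges M. f (the (left M d)) - f (the (right M d)) = force M N k d"
      by (intro closed_dual_form_exact[OF assms(2)]) (auto simp: equilibrium_forces_def)
    then obtain f where f: "\<forall>d\<in>interior_oedges M. dF M f d = k (edge M d) *\<^sub>R dV M N d"
      unfolding dF_def force_def by blast
    then show "\<exists>f :: 'f \<Rightarrow> real^3. A_minimal M N f \<and>
            (\<forall>d\<in>interior_oedges M. dF M f d = k (edge M d) *\<^sub>R dV M N d)"
      using A_minimal_of_parallel[OF assms(4,1)] by blast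
  qed
qed

end
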